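(* Let $p,q\ge 0$ be integers with $p+q\ge 1$. Then the minimum degree of $A_{p,q}$ is $\delta(A_{p,q})=\min\{1,pq\}$ and its maximum degree is $$\Delta(A_{p,q})=\begin{cases}2\min\{p,q\}, & p\ne q,\\ 2p-1, & p=q.\end{cases}$$ Moreover, the number of vertices of degree $d$ in $A_{p,q}$ is equal to $$\begin{cases}2\binom{p-1}{\frac{d-1}{2}}\binom{q-1}{\frac{d-1}{2}}, & d\text{ is odd},\\[6pt] \binom{p-1}{\frac d2-1}\binom{q-1}{\frac d2}+\binom{p-1}{\frac d2}\binom{q-1}{\frac d2-1}, & d\text{ is even}.\end{cases}$$
   Context: For nonnegative integers $p,q$, the graph $A_{p,q}$ is the simple graph whose vertices are all words of length $p+q$ over the alphabet $\{a,b\}$ with exactly $p$ letters $a$ and $q$ letters $b$; two words are adjacent if one can be obtained from the other by changing one subword (block of consecutive letters) $ab$ to $ba$. Binomial coefficients: $\binom{n}{k}\ge 1$ if and only if $0\le k\le n$, and $\binom nk=0$ otherwise.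
   Formalization: The formula for the number of vertices of degree d is claimed only when d > 0 or pq > 0: for d = 0 and pq = 0 the graph is a single vertex of degree 0, while the formula gives 0 under the stated binomial convention. *)

theory Defs
  imports Main
begin

datatype letter = La | Lb

definition words :: "nat \<Rightarrow> nat \<Rightarrow> letter list set" where
  "words p q = {w. length w = p + q \<and> count_list w La = p \<and> count_list w Lb = q}"

definition swap_step :: "letter list \<Rightarrow> letter list \<Rightarrow> bool" where
  "swap_step x y \<longleftrightarrow> (\<exists>u v. x = u @ [La, Lb] @ v \<and> y = u @ [Lb, La] @ v)"

definition word_adj :: "letter list \<Rightarrow> letter list \<Rightarrow> bool" where
  "word_adj x y \<longleftrightarrow> swap_step x y \<or> swap_step y x"

text \<open>A simple graph is represented by its vertex set and a symmetric, irreflexive adjacency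
  relation, which only matters on the vertex set.  The graph of the theorem has vertex set
  \<open>words p q\<close> and adjacency \<open>word_adj\<close>.\<close>

definition degree :: "'v set \<Rightarrow> ('v \<Rightarrow> 'v \<Rightarrow> bool) \<Rightarrow> 'v \<Rightarrow> nat" where
  "degree V E v = card {w \<in> V. E v w}"

text \<open>The following two are meaningful for finite nonempty \<open>V\<close> only.\<close>

definition min_degree :: "'v set \<Rightarrow> ('v \<Rightarrow> 'v \<Rightarrow> bool) \<Rightarrow> nat" where
  "min_degree V E = Min (degree V E ` V)"

definition max_degree :: "'v set \<Rightarrow> ('v \<Rightarrow> 'v \<Rightarrow> bool) \<Rightarrow> nat" where
  "max_degree V E = Max (degree V E ` V)"

text \<open>Binomial coefficient with integer arguments which vanishes unless \<open>0 \<le> k \<le> n\<close>; the arguments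
  may be \<open>-1\<close> below, where truncated subtraction on \<open>nat\<close> would give wrong values.\<close>

definition ibinom :: "int \<Rightarrow> int \<Rightarrow> nat" where
  "ibinom n k = (if 0 \<le> k \<and> k \<le> n then nat n choose nat k else 0)"

lemma word_adj_sym: "word_adj x y \<Longrightarrow> word_adj y x"
  by (auto simp: word_adj_def)

lemma word_adj_irrefl: "\<not> word_adj x x"
  by (auto simp: word_adj_def swap_step_def)

lemma finite_words: "finite (words p q)"
proof (rule finite_subset)
  have "UNIV = {La, Lb}"
    using letter.exhaust by auto
  then have "finite (UNIV :: letter set)"
    by (metis finite.emptyI finite_insert)
  then show "finite {w :: letter list. set w \<subseteq> UNIV \<and> length w = p + q}"
    by (rule finite_lists_length_eq)
qed (auto simp: words_def)

lemma words_nonempty: "words p q \<noteq> {}"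
proof -
  have "count_list (replicate n x) y = (if x = y then n else 0)" for n and x y :: letter
    by (induction n) auto
  then have "replicate p La @ replicate q Lb \<in> words p q"
    by (simp add: words_def)
  then show ?thesis by blast
qed

end

theory Submission
  imports Defs
begin

text \<open>The neighbours of a word arise by swapping two distinct consecutive letters, so its degree is
  one less than its number of runs.  A word with first letter \<open>c\<close> and \<open>d + 1\<close> runs amounts to a
  composition of the number of letters \<open>c\<close> into \<open>\<lfloor>d/2\<rfloor> + 1\<close> parts and a composition of the number of
  remaining letters into \<open>\<lceil>d/2\<rceil>\<close> parts.\<close>

fun changes :: "'a list \<Rightarrow> nat" where
  "changes (x # y # w) = (if x = y then 0 else 1) + changes (y # w)"
| "changes _ = 0"

lemma word_adj_Nil [simp]: "\<not> word_adj [] y"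
  by (auto simp: word_adj_def swap_step_def)

lemma word_adj_singleton [simp]: "\<not> word_adj [c] y"
  by (auto simp: word_adj_def swap_step_def Cons_eq_append_conv)

text \<open>The prefix \<open>u\<close> before the swapped block is either nonempty, and then starts
  with \<open>c\<close>, or empty, and then the block is at the front.\<close>

lemma swap_step_Cons:
  "swap_step (c # x) y \<longleftrightarrow>
    (\<exists>z. y = c # z \<and> swap_step x z) \<or> c = La \<and> (\<exists>v. x = Lb # v \<and> y = Lb # La # v)"
  (is "?l \<longleftrightarrow> ?r")
proof
  assume ?l
  then obtain u v where *: "c # x = u @ [La, Lb] @ v" "y = u @ [Lb, La] @ v"
    by (auto simp: swap_step_def)
  then show ?r
    by (cases u) (auto simp: swap_step_def)
next
  have "swap_step (c # x) (c # z)" if "swap_step x z" for z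
    using that unfolding swap_step_def by (metis append_Cons)
  moreover have "swap_step (La # Lb # v) (Lb # La # v)" for v
    unfolding swap_step_def by (metis append_Nil append_Cons)
  ultimately show "?r \<Longrightarrow> ?l"
    by auto
qed

lemma swap_step_Cons_right:
  "swap_step y (c # x) \<longleftrightarrow>
    (\<exists>z. y = c # z \<and> swap_step z x) \<or> c = Lb \<and> (\<exists>v. x = La # v \<and> y = La # Lb # v)"
  by (cases y) (auto simp: swap_step_Cons swap_step_def[of "[]"])

text \<open>Adjacency allows both directions of the swap, so at the front any two distinct letters
  may be exchanged.\<close>

lemma word_adj_Cons_Cons:
  "word_adj (c # e # w) y \<longleftrightarrow>
    (\<exists>z. y = c # z \<and> word_adj (e # w) z) \<or> c \<noteq> e \<and> y = e # c # w"
  unfolding word_adj_def swap_step_Cons[of c] swap_step_Cons_right[of _ c]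
  by (cases c; cases e) auto

lemma card_neighbours: "finite {y. word_adj w y} \<and> card {y. word_adj w y} = changes w"
proof (induction w rule: changes.induct)
  case (1 x y w)
  \<comment> \<open>The extra neighbour starts with \<open>y\<close>, the others with
    \<open>x\<close>, so for distinct \<open>x\<close> and \<open>y\<close> it is new.\<close>
  have "{z. word_adj (x # y # w) z} =
      (#) x ` {z. word_adj (y # w) z} \<union> (if x = y then {} else {y # x # w})"
    by (auto simp: word_adj_Cons_Cons)
  with 1 show ?case
    by (auto simp: card_image card_insert_if)
qed simp_all

lemma word_adj_words: "word_adj w y \<Longrightarrow> w \<in> words p q \<Longrightarrow> y \<in> words p q"
  by (auto simp: word_adj_def swap_step_def words_def)

lemma degree_words: "w \<in> words p q \<Longrightarrow> degree (words p q) word_adj w = changes w"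
proof -
  assume "w \<in> words p q"
  then have "{y \<in> words p q. word_adj w y} = {y. word_adj w y}"
    using word_adj_words by blast
  then show ?thesis
    by (simp add: degree_def card_neighbours)
qed

text \<open>Compositions of \<open>n\<close> into \<open>k\<close> positive parts. The empty
  composition of 0 needs its own case, since \<open>ibinom (-1) (-1)\<close> is 0.\<close>

definition compositions :: "nat \<Rightarrow> nat \<Rightarrow> nat" where
  "compositions n k = (if n = 0 \<and> k = 0 then 1 else ibinom (int n - 1) (int k - 1))"

lemma compositions_0_0 [simp]: "compositions 0 0 = 1"
  by (simp add: compositions_def)

lemma compositions_0_left [simp]: "0 < k \<Longrightarrow> compositions 0 k = 0"
  by (simp add: compositions_def ibinom_def)

lemma compositions_0_right [simp]: "0 < n \<Longrightarrow> compositions n 0 = 0"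
  by (simp add: compositions_def ibinom_def)

lemma compositions_Suc_Suc: "compositions (Suc n) (Suc k) = n choose k"
  by (auto simp: compositions_def ibinom_def binomial_eq_0)

text \<open>Pascal's rule: a first part equal to 1 is removed, a larger one is lowered by 1.\<close>

lemma compositions_Suc: "compositions (Suc n) (Suc k) = compositions n k + compositions n (Suc k)"
  by (cases n; cases k) (simp_all add: compositions_Suc_Suc)

lemma compositions_pos_iff: "compositions n k > 0 \<longleftrightarrow> n = 0 \<and> k = 0 \<or> 0 < k \<and> k \<le> n"
  by (cases n; cases k) (auto simp: compositions_Suc_Suc)

fun other :: "letter \<Rightarrow> letter" where
  "other La = Lb"
| "other Lb = La"

lemma other_other [simp]: "other (other c) = c"
  by (cases c) auto

lemma other_neq [simp]: "other c \<noteq> c" "c \<noteq> other c"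
  by (cases c; simp)+

lemma neq_iff_other: "x \<noteq> c \<longleftrightarrow> x = other c"
  by (cases c; cases x) auto

text \<open>Here \<open>m\<close> counts the first letter \<open>c\<close>, whichever it is, so that
  an induction may exchange the roles of the two letters.\<close>

definition words_from :: "letter \<Rightarrow> nat \<Rightarrow> nat \<Rightarrow> nat \<Rightarrow> letter list set" where
  "words_from c m n d =
    {w. w \<noteq> [] \<and> hd w = c \<and> count_list w c = m \<and> count_list w (other c) = n \<and> changes w = d}"

lemma words_from_0: "words_from c 0 n d = {}"
  by (auto simp: words_from_def count_list_0_iff)

text \<open>Delete the first letter: the rest is empty, starts with \<open>c\<close> again, or
  starts with the other letter and has one change fewer.\<close>

lemma words_from_Suc:
  "words_from c (Suc m) n d = (#) c `
    ((if m = 0 \<and> n = 0 \<and> d = 0 then {[]} else {}) \<union> words_from c m n d \<union>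
     (if d = 0 then {} else words_from (other c) n m (d - 1)))" (is "?L = (#) c ` ?R")
proof -
  have mem: "c # u \<in> ?L \<longleftrightarrow> u \<in> ?R" for u
  proof (cases u)
    case Nil
    then show ?thesis by (auto simp: words_from_def)
  next
    case (Cons x v)
    then show ?thesis
      by (cases "x = c") (auto simp: words_from_def neq_iff_other)
  qed
  have "w \<in> ?L \<Longrightarrow> w \<in> (#) c ` ?R" for w
    using mem[of "tl w"] by (cases w) (auto simp: words_from_def)
  then show ?thesis
    using mem by blast
qed

text \<open>Deleting the first letter of a word shortens or removes its first run; the resulting
  recursion is \<open>compositions_Suc\<close> applied to the factor for \<open>m\<close>.\<close>

lemma card_words_from:
  "finite (words_from c m n d) \<and>
   card (words_from c m n d) = compositions m (d div 2 + 1) * compositions n ((d + 1) div 2)"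
proof (induction "m + n" arbitrary: c m n d rule: less_induct)
  case less
  show ?case
  proof (cases m)
    case 0
    then show ?thesis by (simp add: words_from_0)
  next
    case (Suc k)
    have IH1: "finite (words_from c k n d)"
      "card (words_from c k n d) = compositions k (d div 2 + 1) * compositions n ((d + 1) div 2)"
      using less Suc by auto
    have IH2: "finite (words_from (other c) n k e)"
      "card (words_from (other c) n k e) =
        compositions n (e div 2 + 1) * compositions k ((e + 1) div 2)" for e
      using less[of n k "other c" e] Suc by (auto simp: add.commute)
    have disj: "words_from c k n d \<inter> words_from (other c) n k e = {}"
      "[] \<notin> words_from b k' n' e" for b k' n' e
      by (auto simp: words_from_def)
    show ?thesis
    proof (cases d)
      case 0
      \<comment> \<open>The empty remainder contributes
        \<open>compositions k 0 * compositions n 0\<close>, which is nonzero only for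
        \<open>k = n = 0\<close>.\<close>
      show ?thesis
        using IH1 0 Suc disj
        by (cases k; cases n)
          (simp_all add: words_from_Suc card_image compositions_Suc words_from_0)
    next
      case (Suc e)
      \<comment> \<open>With \<open>d = e + 1\<close> this matches the number of runs of the other
        letter before and after the deletion.\<close>
      have "(e + 2) div 2 = e div 2 + 1"
        by simp
      then show ?thesis
        using IH1 IH2[of e] Suc \<open>m = Suc k\<close> disj
        by (simp add: words_from_Suc card_image card_Un_disjoint compositions_Suc algebra_simps)
    qed
  qed
qed

lemma length_eq_count: "length w = count_list w La + count_list w Lb"
proof (induction w)
  case (Cons x w)
  then show ?case by (cases x) auto
qed simp

text \<open>The words are split by their first letter; \<open>p + q \<ge> 1\<close> excludes the
  empty word, which has none.\<close>

lemma card_words_degree: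
  assumes "p + q \<ge> 1"
  shows "card {w \<in> words p q. degree (words p q) word_adj w = d} =
    compositions p (d div 2 + 1) * compositions q ((d + 1) div 2) +
    compositions q (d div 2 + 1) * compositions p ((d + 1) div 2)"
proof -
  have "{w \<in> words p q. degree (words p q) word_adj w = d} = {w \<in> words p q. changes w = d}"
    using degree_words by auto
  also have "\<dots> = words_from La p q d \<union> words_from Lb q p d"
  proof -
    have "hd w = La \<or> hd w = Lb" for w :: "letter list"
      using letter.exhaust by blast
    then show ?thesis
      using assms by (auto simp: words_def words_from_def length_eq_count)
  qed
  also have "card \<dots> = card (words_from La p q d) + card (words_from Lb q p d)"
    by (intro card_Un_disjoint) (auto simp: card_words_from, auto simp: words_from_def)
  finally show ?thesis
    by (simp add: card_words_from)
qed

text \<open>A degree occurs iff its count is positive, which reduces both extremal degrees to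
  arithmetic.\<close>

lemma degree_attained_iff:
  assumes "p + q \<ge> 1"
  shows "d \<in> degree (words p q) word_adj ` words p q \<longleftrightarrow>
    d div 2 < p \<and> (q = 0 \<and> d = 0 \<or> 0 < d \<and> (d + 1) div 2 \<le> q) \<or>
    d div 2 < q \<and> (p = 0 \<and> d = 0 \<or> 0 < d \<and> (d + 1) div 2 \<le> p)"
proof -
  have "d \<in> degree (words p q) word_adj ` words p q \<longleftrightarrow>
      card {w \<in> words p q. degree (words p q) word_adj w = d} > 0"
    using finite_words by (auto simp: card_gt_0_iff)
  also have "\<dots> \<longleftrightarrow>
      compositions p (d div 2 + 1) > 0 \<and> compositions q ((d + 1) div 2) > 0 \<or>
      compositions q (d div 2 + 1) > 0 \<and> compositions p ((d + 1) div 2) > 0"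
    by (simp only: card_words_degree[OF assms] add_gr_0 nat_0_less_mult_iff)
  finally show ?thesis
    unfolding compositions_pos_iff by (cases d) auto
qed

text \<open>The case \<open>d = 0\<close>, \<open>p * q = 0\<close> is left out of the count: the
  graph then has a single vertex, of degree 0, while the formula gives 0.\<close>

theorem proposition3p5:
  fixes p q :: nat
  assumes "p + q \<ge> 1"
  shows "min_degree (words p q) word_adj = min 1 (p * q)
    \<and> max_degree (words p q) word_adj = (if p \<noteq> q then 2 * min p q else 2 * p - 1)
    \<and> (\<forall>d::nat. d > 0 \<or> p * q > 0 \<longrightarrow>
         card {w \<in> words p q. degree (words p q) word_adj w = d} =
           (if odd d
            then 2 * ibinom (int p - 1) ((int d - 1) div 2) * ibinom (int q - 1) ((int d - 1) div 2)
            else ibinom (int p - 1) (int d div 2 - 1) * ibinom (int q - 1) (int d div 2)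
               + ibinom (int p - 1) (int d div 2) * ibinom (int q - 1) (int d div 2 - 1)))"
proof (intro conjI allI impI)
  let ?D = "degree (words p q) word_adj ` words p q"
  have fin: "finite ?D"
    by (simp add: finite_words)
  note attained = degree_attained_iff[OF assms]
  show "min_degree (words p q) word_adj = min 1 (p * q)"
    unfolding min_degree_def
  proof (rule Min_eqI[OF fin])
    show "min 1 (p * q) \<in> ?D"
      using assms unfolding attained by (cases "p = 0"; cases "q = 0") (auto simp: min_def)
    show "min 1 (p * q) \<le> d" if "d \<in> ?D" for d
      using that unfolding attained by (cases "d = 0") auto
  qed
  show "max_degree (words p q) word_adj = (if p \<noteq> q then 2 * min p q else 2 * p - 1)"
    unfolding max_degree_def
  proof (rule Max_eqI[OF fin])
    \<comment> \<open>The rarer letter has only runs of length 1. For \<open>p \<noteq> q\<close>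
      the other letter can have one run more; for \<open>p = q\<close> both have \<open>p\<close>
      runs.\<close>
    show "(if p \<noteq> q then 2 * min p q else 2 * p - 1) \<in> ?D"
      using assms unfolding attained min_def by auto presburger
    show "d \<le> (if p \<noteq> q then 2 * min p q else 2 * p - 1)" if "d \<in> ?D" for d
      using that unfolding attained min_def by auto
  qed
  show "card {w \<in> words p q. degree (words p q) word_adj w = d} =
      (if odd d
       then 2 * ibinom (int p - 1) ((int d - 1) div 2) * ibinom (int q - 1) ((int d - 1) div 2)
       else ibinom (int p - 1) (int d div 2 - 1) * ibinom (int q - 1) (int d div 2)
          + ibinom (int p - 1) (int d div 2) * ibinom (int q - 1) (int d div 2 - 1))"
    if "d > 0 \<or> p * q > 0" for d
  proof -
    \<comment> \<open>This rules out the exceptional case of \<open>compositions\<close>. For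
      \<open>d = 0\<close> the lower index becomes -1, hence the integer arguments.\<close>
    have "(d + 1) div 2 > 0 \<or> p > 0 \<and> q > 0"
      using that by auto
    then have "compositions n (d div 2 + 1) = ibinom (int n - 1) (int d div 2)"
      "n \<in> {p, q} \<Longrightarrow>
        compositions n ((d + 1) div 2) = ibinom (int n - 1) ((int d + 1) div 2 - 1)" for n
      by (auto simp: compositions_def zdiv_int add.commute)
    then have card_eq: "card {w \<in> words p q. degree (words p q) word_adj w = d} =
        ibinom (int p - 1) (int d div 2) * ibinom (int q - 1) ((int d + 1) div 2 - 1) +
        ibinom (int q - 1) (int d div 2) * ibinom (int p - 1) ((int d + 1) div 2 - 1)"
      by (simp add: card_words_degree[OF assms])
    show ?thesis
    \<comment> \<open>For odd \<open>d\<close> both letters have equally many runs, so the two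
      products coincide; for even \<open>d\<close> the first letter has one run more.\<close>
    proof (cases "odd d")
      case True
      then have "int d div 2 = (int d - 1) div 2" "(int d + 1) div 2 - 1 = (int d - 1) div 2"
        by presburger+
      then show ?thesis
        using True by (simp add: card_eq)
    next
      case False
      then have "(int d + 1) div 2 = int d div 2"
        by presburger
      then show ?thesis
        using False by (simp add: card_eq)
    qed
  qed
qed

end
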